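(* Let $\sigma$ be a real number, let $a$ be an arbitrary real number with $a\neq\sigma$, and let $R$ be a multiset of complex numbers $\rho$ such that (i) $2\sigma-a\notin R$ and $a\notin R$; (ii) $\displaystyle\sum_{\rho\in R}\frac{1+|\operatorname{Re}\rho|}{1+|\rho+a-2\sigma|^2}<+\infty$ and $\displaystyle\sum_{\rho\in R}\frac{1+|\operatorname{Re}\rho|}{1+|\rho-a|^2}<+\infty$; (iii) if $\rho\in R$, then $2\sigma-\rho\in R$. Then the following conditions are equivalent: (a) $\operatorname{Re}\rho=\sigma$ for every $\rho\in R$; (b) $\displaystyle\sum_{\rho\in R}\operatorname{Re}\left(1-\left(\frac{\rho-a}{\rho+a-2\sigma}\right)^n\right)\ge 0$ for $n=1,2,3,\dots$; (c) for every fixed $\varepsilon>0$ there is a positive constant $c(\varepsilon,a)$ such that $$\sum_{\rho\in R}\operatorname{Re}\left(1-\left(\frac{\rho-a}{\rho+a-2\sigma}\right)^n\right)\ge -c(\varepsilon,a)e^{\varepsilon n}\qquad\text{for } n=1,2,3,\dots$$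
   Context: Sums over the multiset $R$ are taken with multiplicity: each element contributes as many times as its multiplicity in $R$. *)

theory Defs
  imports "HOL-Analysis.Analysis"
begin

text \<open>
  The library type of multisets contains finite multisets only. The multisets needed here may be
  infinite (with finite multiplicities), so a multiset is given by its multiplicity function.
  A positive series in which some element is repeated infinitely often diverges, so
  the summability assumptions below exclude infinite multiplicities anyway.
\<close>

type_synonym 'a multiplicity = "'a \<Rightarrow> nat"

definition elems_of :: "'a multiplicity \<Rightarrow> 'a set" where
  "elems_of R = {x. R x > 0}"

definition multi_summable :: "'a multiplicity \<Rightarrow> ('a \<Rightarrow> real) \<Rightarrow> bool" where
  "multi_summable R f \<longleftrightarrow> (\<lambda>x. real (R x) * f x) summable_on elems_of R"

definition multi_sum :: "'a multiplicity \<Rightarrow> ('a \<Rightarrow> real) \<Rightarrow> real" where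
  "multi_sum R f = (\<Sum>\<^sub>\<infinity>x\<in>elems_of R. real (R x) * f x)"

text \<open>
  Put \<open>w = (\<rho> - a) / (\<rho> + a - 2 \<sigma>) = 1 + u\<close> with \<open>u = 2 (\<sigma> - a) / (\<rho> + a - 2 \<sigma>)\<close>. If the sum over
  \<open>R\<close> of \<open>(1 + \<bar>Re \<rho>\<bar>) / (1 + |\<rho> + a - 2 \<sigma>|^2)\<close> is finite and \<open>2 \<sigma> - a\<close> is not in \<open>R\<close>, then \<open>u\<close> is
  bounded on \<open>R\<close>, and \<open>Re (1 - w ^ n) = - n Re u + O(|u|^2)\<close> for fixed \<open>n\<close>, so the sum below
  converges absolutely and \<open>infsum\<close> does not fall back on its default value.
\<close>

definition li_sum :: "real \<Rightarrow> real \<Rightarrow> complex multiplicity \<Rightarrow> nat \<Rightarrow> real" where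
  "li_sum \<sigma> a R n =
     multi_sum R (\<lambda>\<rho>. Re (1 - ((\<rho> - of_real a) / (\<rho> + of_real a - 2 * of_real \<sigma>)) ^ n))"

end

theory Submission
  imports Defs "HOL-Real_Asymp.Real_Asymp"
begin

text \<open>
  Put \<open>w(\<rho>) = (\<rho> - a) / (\<rho> + a - 2 \<sigma>)\<close>. This Moebius transformation sends the line
  \<open>Re \<rho> = \<sigma>\<close> into the unit circle, and it turns the reflection \<open>\<rho> \<mapsto> 2 \<sigma> - \<rho>\<close> into
  \<open>w \<mapsto> 1 / w\<close>. If (a) holds, all \<open>w(\<rho>) ^ n\<close> have modulus 1, so every term
  \<open>Re (1 - w(\<rho>) ^ n)\<close> is nonnegative; this gives (b), and (c) is weaker than (b).

  The content is that (c) forces \<open>|w(\<rho>)| \<le> 1\<close> throughout \<open>R\<close>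
  (\<open>norm_le_1_if_power_sums_subexponential\<close>); applied also to \<open>2 \<sigma> - \<rho>\<close>, this gives
  \<open>|w(\<rho>)| = 1\<close> and hence (a). Suppose some \<open>|w(\<rho>)|\<close> exceeds 1. Since
  \<open>\<Sum> |w(\<rho>) - 1|^2\<close> converges, only finitely many \<open>|w(\<rho>)|\<close> exceed a given bound above 1, so a
  maximal modulus \<open>M > 1\<close> is attained, on a finite set \<open>F\<close>, and all other moduli are at most some
  \<open>r\<close> with \<open>1 < r < M\<close> (\<open>dominant_modulus_gap\<close>). The other terms together
  contribute at most \<open>O(n^2 r^n)\<close>, because \<open>w^n\<close> differs from its linearisation \<open>1 + n (w - 1)\<close> by
  at most \<open>n^2 r^n |w - 1|^2\<close>, while \<open>\<Sum> |Re (w - 1)|\<close> and \<open>\<Sum> |w - 1|^2\<close>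
  converge (\<open>norm_power_linear_error_le\<close>, \<open>weighted_power_sum_bound\<close>). Dirichlet's simultaneous approximation theorem provides arbitrarily
  large \<open>n\<close> for which all the powers \<open>w^n\<close> coming from \<open>F\<close> have real part at least \<open>M^n / 2\<close>
  (\<open>simultaneously_large_Re_power\<close>). When such an \<open>n\<close> is large enough, the sum is below
  \<open>- c r^n\<close> for any prescribed \<open>c\<close>, against (c) with \<open>\<epsilon> = ln r\<close>.
\<close>

section \<open>Powers of complex numbers\<close>

text \<open>
  Dirichlet's theorem makes the multiples of finitely many angles simultaneously close to whole
  turns; only the angles matter, so the moduli may be arbitrary. It gives no lower bound on the
  multiplier \<open>q\<close>; approximating the angles multiplied by \<open>L\<close> makes the exponent \<open>L q\<close> at least \<open>L\<close>.
\<close>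

lemma simultaneously_large_Re_power:
  fixes F :: "complex set" and L :: nat
  assumes "finite F" and "L \<ge> 1"
  shows "\<exists>n\<ge>L. \<forall>z\<in>F. Re (z ^ n) \<ge> cmod z ^ n / 2"
proof -
  obtain z :: "nat \<Rightarrow> complex" and k where F: "F = z ` {i. i < k}"
    using finite_imp_nat_seg_image_inj_on[OF \<open>finite F\<close>] by blast
  define \<theta> where "\<theta> i = real L * Arg (z i) / (2 * pi)" for i
  \<comment> \<open>An error of a sixth of a turn keeps the cosine at least \<open>1 / 2\<close>.\<close>
  obtain q p where q: "0 < q" and qp: "\<And>i. i < k \<Longrightarrow> \<bar>of_int q * \<theta> i - of_int (p i)\<bar> < 1 / real 6"
    using Dirichlet_approx_simult[of 6 k \<theta>] by (metis zero_less_numeral)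
  define n where "n = L * nat q"
  have "n \<ge> L"
    using q by (cases "nat q") (auto simp: n_def)
  moreover have "Re (z i ^ n) \<ge> cmod (z i) ^ n / 2" if "i < k" for i
  proof -
    define \<phi> where "\<phi> = 2 * pi * (of_int q * \<theta> i - of_int (p i))"
    have "z i ^ n = of_real (cmod (z i) ^ n) * cis (real n * Arg (z i))"
      by (metis DeMoivre2 rcis_cmod_Arg rcis_def)
    hence "Re (z i ^ n) = cmod (z i) ^ n * cos (real n * Arg (z i))"
      by simp
    also have "real n * Arg (z i) = \<phi> + 2 * pi * of_int (p i)"
      using q by (simp add: n_def \<phi>_def \<theta>_def field_simps)
    also have "cos \<dots> = cos \<phi>"
      by (simp add: cos_add)
    finally have "Re (z i ^ n) = cmod (z i) ^ n * cos \<phi>" .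
    moreover have "cos \<phi> \<ge> 1 / 2"
    proof -
      have "\<bar>\<phi>\<bar> \<le> 2 * pi * (1 / 6)"
        using qp[OF that] unfolding \<phi>_def abs_mult by (intro mult_mono) auto
      hence "cos \<bar>\<phi>\<bar> \<ge> cos (pi / 3)"
        by (intro cos_monotone_0_pi_le) auto
      thus ?thesis by (simp add: cos_60)
    qed
    ultimately show ?thesis
      using mult_left_mono[of "1 / 2" "cos \<phi>" "cmod (z i) ^ n"] by simp
  qed
  ultimately show ?thesis
    unfolding F by blast
qed

text \<open>
  The error of the linearisation is \<open>(w - 1)^2\<close> times a sum of at most \<open>n^2\<close> powers of \<open>w\<close> with
  exponents below \<open>n\<close>. It has to be quadratic in \<open>w - 1\<close>, since \<open>\<Sum> |w - 1|\<close> need not converge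
  over the families considered below.
\<close>

lemma norm_power_linear_error_le:
  fixes w :: complex
  assumes "cmod w \<le> r" and "1 \<le> r"
  shows "cmod (w ^ n - 1 - of_nat n * (w - 1)) \<le> (real n)\<^sup>2 * r ^ n * (cmod (w - 1))\<^sup>2"
proof (induction n)
  case 0
  show ?case by simp
next
  case (Suc n)
  define D where "D = w ^ n - 1 - of_nat n * (w - 1)"
  have "w ^ Suc n - 1 - of_nat (Suc n) * (w - 1) = w * D + of_nat n * (w - 1)\<^sup>2"
    by (simp add: D_def algebra_simps power2_eq_square)
  also have "cmod \<dots> \<le> cmod w * cmod D + real n * (cmod (w - 1))\<^sup>2"
    by (rule norm_triangle_le) (simp add: norm_mult norm_power)
  also have "\<dots> \<le> r * ((real n)\<^sup>2 * r ^ n * (cmod (w - 1))\<^sup>2)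
                  + real n * (cmod (w - 1))\<^sup>2 * r ^ Suc n"
  proof (rule add_mono)
    show "cmod w * cmod D \<le> r * ((real n)\<^sup>2 * r ^ n * (cmod (w - 1))\<^sup>2)"
      unfolding D_def using Suc assms by (intro mult_mono) auto
    show "real n * (cmod (w - 1))\<^sup>2 \<le> real n * (cmod (w - 1))\<^sup>2 * r ^ Suc n"
      using mult_left_mono[OF one_le_power[OF assms(2)], of "real n * (cmod (w - 1))\<^sup>2" "Suc n"]
      by simp
  qed
  also have "\<dots> = ((real n)\<^sup>2 + real n) * (r ^ Suc n * (cmod (w - 1))\<^sup>2)"
    by (simp add: algebra_simps)
  also have "\<dots> \<le> (real (Suc n))\<^sup>2 * (r ^ Suc n * (cmod (w - 1))\<^sup>2)"
    using assms by (intro mult_right_mono) (auto simp: power2_eq_square algebra_simps)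
  finally show ?case by (simp add: mult.assoc)
qed

lemma abs_Re_one_minus_power_le:
  fixes w :: complex
  assumes "cmod w \<le> r" and "1 \<le> r"
  shows "\<bar>Re (1 - w ^ n)\<bar> \<le> real n * \<bar>Re (w - 1)\<bar> + (real n)\<^sup>2 * r ^ n * (cmod (w - 1))\<^sup>2"
proof -
  have "Re (1 - w ^ n) = - (real n * Re (w - 1)) - Re (w ^ n - 1 - of_nat n * (w - 1))"
    by (simp add: algebra_simps)
  also have "\<bar>\<dots>\<bar> \<le> \<bar>real n * Re (w - 1)\<bar> + cmod (w ^ n - 1 - of_nat n * (w - 1))"
    using abs_Re_le_cmod[of "w ^ n - 1 - of_nat n * (w - 1)"] by linarith
  finally show ?thesis
    using norm_power_linear_error_le[OF assms, of n] by (simp add: abs_mult)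
qed

section \<open>Sums of powers over an infinite family\<close>

lemma finite_superlevel_if_summable_on:
  fixes f :: "'a \<Rightarrow> real"
  assumes "f summable_on S" and "\<And>x. x \<in> S \<Longrightarrow> 0 \<le> f x" and "0 < \<delta>"
  shows "finite {x \<in> S. \<delta> \<le> f x}"
proof (rule ccontr)
  assume inf: "infinite {x \<in> S. \<delta> \<le> f x}"
  obtain N :: nat where N: "infsum f S < real N * \<delta>"
    using reals_Archimedean3[OF assms(3)] by blast
  obtain T where T: "T \<subseteq> {x \<in> S. \<delta> \<le> f x}" "finite T" "card T = N"
    using infinite_arbitrarily_large[OF inf] by blast
  have "real N * \<delta> \<le> sum f T"
    using sum_bounded_below[of T \<delta> f] T by auto
  also have "\<dots> \<le> infsum f S"
    using T assms by (intro finite_sum_le_infsum) auto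
  finally show False using N by simp
qed

text \<open>
  Summing the linearisation bound over the whole family. Only the exponential rate \<open>r\<close> in \<open>n\<close> is
  essential, the polynomial factors are harmless.
\<close>

lemma weighted_power_sum_bound:
  fixes w :: "'a \<Rightarrow> complex" and m :: "'a \<Rightarrow> real"
  assumes m: "\<And>x. x \<in> S \<Longrightarrow> 0 \<le> m x"
    and s1: "(\<lambda>x. m x * \<bar>Re (w x - 1)\<bar>) summable_on S"
    and s2: "(\<lambda>x. m x * (cmod (w x - 1))\<^sup>2) summable_on S"
    and r: "\<And>x. x \<in> S \<Longrightarrow> cmod (w x) \<le> r" "1 \<le> r"
  shows "(\<lambda>x. m x * Re (1 - w x ^ n)) summable_on S"
    and "infsum (\<lambda>x. m x * Re (1 - w x ^ n)) S
         \<le> real n * infsum (\<lambda>x. m x * \<bar>Re (w x - 1)\<bar>) S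
           + (real n)\<^sup>2 * r ^ n * infsum (\<lambda>x. m x * (cmod (w x - 1))\<^sup>2) S"
proof -
  let ?g = "\<lambda>x. real n * (m x * \<bar>Re (w x - 1)\<bar>) + (real n)\<^sup>2 * r ^ n * (m x * (cmod (w x - 1))\<^sup>2)"
  have g: "?g summable_on S"
    by (intro summable_on_add summable_on_cmult_right s1 s2)
  have le: "\<bar>m x * Re (1 - w x ^ n)\<bar> \<le> ?g x" if "x \<in> S" for x
    using mult_left_mono[OF abs_Re_one_minus_power_le[OF r(1)[OF that] r(2), of n] m[OF that]] m[OF that]
    unfolding abs_mult distrib_left by (simp only: abs_of_nonneg mult_ac)
  show *: "(\<lambda>x. m x * Re (1 - w x ^ n)) summable_on S"
    by (rule abs_summable_summable, rule Infinite_Sum.abs_summable_on_comparison_test'[OF g])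
       (simp only: real_norm_def le)
  have "infsum (\<lambda>x. m x * Re (1 - w x ^ n)) S \<le> infsum ?g S"
    using le by (intro infsum_mono * g) (meson abs_le_D1)
  also have "\<dots> = real n * infsum (\<lambda>x. m x * \<bar>Re (w x - 1)\<bar>) S
           + (real n)\<^sup>2 * r ^ n * infsum (\<lambda>x. m x * (cmod (w x - 1))\<^sup>2) S"
    by (simp only: infsum_add infsum_cmult_right s1 s2 summable_on_cmult_right)
  finally show "infsum (\<lambda>x. m x * Re (1 - w x ^ n)) S \<le> \<dots>" .
qed

text \<open>
  Only the finitely many elements above a level between 1 and \<open>|w y|\<close> compete for the largest and
  second largest modulus, so a largest modulus exists and is isolated. The bound \<open>r\<close>
  for the remaining elements is kept above 1, because it also has to control those elements whose moduli are at most 1.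
\<close>

lemma dominant_modulus_gap:
  fixes w :: "'a \<Rightarrow> complex"
  assumes fin: "\<And>t. 1 < t \<Longrightarrow> finite {x \<in> S. t \<le> cmod (w x)}"
    and y: "y \<in> S" "1 < cmod (w y)"
  obtains M r where "1 < r" "r < M" "finite {x \<in> S. cmod (w x) = M}" "{x \<in> S. cmod (w x) = M} \<noteq> {}"
    and "\<And>x. x \<in> S \<Longrightarrow> cmod (w x) \<noteq> M \<Longrightarrow> cmod (w x) \<le> r"
proof -
  \<comment> \<open>Any threshold strictly between 1 and \<open>|w y|\<close> would do.\<close>
  define t where "t = (1 + cmod (w y)) / 2"
  have t: "1 < t" "t < cmod (w y)"
    using y by (auto simp: t_def)
  define G where "G = {x \<in> S. t \<le> cmod (w x)}"
  have G: "finite G" "y \<in> G"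
    using fin[OF t(1)] y t by (auto simp: G_def)
  define M where "M = Max ((\<lambda>x. cmod (w x)) ` G)"
  have M_ge: "cmod (w x) \<le> M" if "x \<in> G" for x
    using that G by (auto simp: M_def)
  have M_in: "M \<in> (\<lambda>x. cmod (w x)) ` G"
    unfolding M_def using G by (intro Max_in) auto
  have tM: "t < M"
    using M_ge[OF G(2)] t by simp
  define r where "r = Max (insert t ((\<lambda>x. cmod (w x)) ` {x \<in> G. cmod (w x) \<noteq> M}))"
  have r_in: "r \<in> insert t ((\<lambda>x. cmod (w x)) ` {x \<in> G. cmod (w x) \<noteq> M})"
    unfolding r_def using G by (intro Max_in) auto
  show thesis
  proof (rule that[of r M])
    show "1 < r"
      using t(1) G unfolding r_def by (subst Max_gr_iff) auto
    show "r < M"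
      using r_in tM M_ge by force
    have "{x \<in> S. cmod (w x) = M} \<subseteq> G"
      using tM by (auto simp: G_def)
    thus "finite {x \<in> S. cmod (w x) = M}"
      using G finite_subset by blast
    show "{x \<in> S. cmod (w x) = M} \<noteq> {}"
      using M_in by (auto simp: G_def)
    show "cmod (w x) \<le> r" if "x \<in> S" "cmod (w x) \<noteq> M" for x
    proof (cases "x \<in> G")
      case True
      thus ?thesis using that G by (auto simp: r_def intro!: Max_ge)
    next
      case False
      hence "cmod (w x) \<le> t" using that by (auto simp: G_def)
      also have "t \<le> r" using G by (auto simp: r_def intro!: Max_ge)
      finally show ?thesis .
    qed
  qed
qed

text \<open>
  The numerical contradiction behind the main argument: a term of order \<open>M^n\<close> outgrows everything
  of order \<open>n^2 r^n\<close>. Dividing by \<open>r^n\<close> reduces this to a polynomial against the geometric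
  sequence of ratio \<open>M / r\<close>.
\<close>

lemma eventually_power_dominates:
  fixes r M \<mu> c K1 K2 :: real
  assumes "1 < r" and "r < M" and "0 < \<mu>" and "0 \<le> c"
  shows "eventually (\<lambda>n. \<mu> + real n * K1 + (real n)\<^sup>2 * r ^ n * K2 + c * r ^ n < \<mu> * M ^ n / 2)
           sequentially"
proof -
  define q where "q = M / r"
  have q: "1 < q" using assms by (simp add: q_def)
  define P where "P n = \<mu> + c + real n * \<bar>K1\<bar> + (real n)\<^sup>2 * \<bar>K2\<bar>" for n :: nat
  have "(\<lambda>n. P n / q ^ n) \<longlonglongrightarrow> 0"
    unfolding P_def using q by real_asymp
  hence "eventually (\<lambda>n. P n / q ^ n < \<mu> / 2) sequentially"
    using assms by (intro order_tendstoD) auto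
  thus ?thesis
  proof eventually_elim
    case (elim n)
    have r1: "1 \<le> r ^ n" using assms by (simp add: one_le_power)
    have "\<mu> \<le> \<mu> * r ^ n"
      using r1 assms by simp
    moreover have "real n * K1 \<le> real n * \<bar>K1\<bar> * r ^ n"
      using mult_mono[of "real n * K1" "real n * \<bar>K1\<bar>" 1 "r ^ n"] r1 by (simp add: mult_left_mono)
    moreover have "(real n)\<^sup>2 * r ^ n * K2 \<le> (real n)\<^sup>2 * r ^ n * \<bar>K2\<bar>"
      using assms by (intro mult_left_mono) auto
    ultimately have "\<mu> + real n * K1 + (real n)\<^sup>2 * r ^ n * K2 + c * r ^ n \<le> P n * r ^ n"
      by (simp add: P_def algebra_simps)
    also have "P n < \<mu> / 2 * q ^ n"
      using elim q by (simp add: pos_divide_less_eq)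
    hence "P n * r ^ n < \<mu> / 2 * q ^ n * r ^ n"
      using r1 by (intro mult_strict_right_mono) auto
    also have "\<dots> = \<mu> * M ^ n / 2"
      using assms by (simp add: q_def power_divide)
    finally show ?case .
  qed
qed

text \<open>
  This is where oscillation is excluded. A single \<open>w\<close> of modulus \<open>M > 1\<close> makes \<open>Re (1 - w^n)\<close>
  of size up to \<open>M^n\<close>, in general with varying sign, and several of them could conceivably cancel;
  at large exponents from Dirichlet's theorem they are all negative together. Weights at
  least 1 model multiplicities: they turn the convergence of \<open>\<Sum> m |w - 1|^2\<close> into finiteness of the set of \<open>x\<close> for
  which \<open>w x\<close> is far from 1.
\<close>

theorem norm_le_1_if_power_sums_subexponential:
  fixes w :: "'a \<Rightarrow> complex" and m :: "'a \<Rightarrow> real"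
  assumes m: "\<And>x. x \<in> S \<Longrightarrow> 1 \<le> m x"
    and s1: "(\<lambda>x. m x * \<bar>Re (w x - 1)\<bar>) summable_on S"
    and s2: "(\<lambda>x. m x * (cmod (w x - 1))\<^sup>2) summable_on S"
    and lower: "\<And>\<epsilon>. 0 < \<epsilon> \<Longrightarrow> \<exists>c>0. \<forall>n\<ge>1.
                  infsum (\<lambda>x. m x * Re (1 - w x ^ n)) S \<ge> - c * exp (\<epsilon> * real n)"
    and x0: "x0 \<in> S"
  shows "cmod (w x0) \<le> 1"
proof (rule ccontr)
  assume "\<not> cmod (w x0) \<le> 1"
  hence gt: "1 < cmod (w x0)" by simp
  have m0: "0 \<le> m x" if "x \<in> S" for x
    using m[OF that] by simp
  have fin: "finite {x \<in> S. t \<le> cmod (w x)}" if t: "1 < t" for t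
  proof (rule finite_subset)
    show "finite {x \<in> S. (t - 1)\<^sup>2 \<le> m x * (cmod (w x - 1))\<^sup>2}"
      using t m0 by (intro finite_superlevel_if_summable_on[OF s2]) auto
    show "{x \<in> S. t \<le> cmod (w x)} \<subseteq> {x \<in> S. (t - 1)\<^sup>2 \<le> m x * (cmod (w x - 1))\<^sup>2}"
    proof safe
      fix x assume x: "x \<in> S" "t \<le> cmod (w x)"
      have "cmod (w x) \<le> cmod (w x - 1) + 1"
        using norm_triangle_ineq[of "w x - 1" 1] by simp
      hence "(t - 1)\<^sup>2 \<le> (cmod (w x - 1))\<^sup>2"
        using t x by (intro power_mono) auto
      also have "\<dots> \<le> m x * (cmod (w x - 1))\<^sup>2"
        using mult_right_mono[OF m[OF x(1)], of "(cmod (w x - 1))\<^sup>2"] by simp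
      finally show "(t - 1)\<^sup>2 \<le> m x * (cmod (w x - 1))\<^sup>2" .
    qed
  qed
  obtain M r where r: "1 < r" "r < M" and finF: "finite {x \<in> S. cmod (w x) = M}"
    and F_ne: "{x \<in> S. cmod (w x) = M} \<noteq> {}"
    and rest: "\<And>x. x \<in> S \<Longrightarrow> cmod (w x) \<noteq> M \<Longrightarrow> cmod (w x) \<le> r"
    by (rule dominant_modulus_gap[where S = S and w = w and y = x0, OF _ x0 gt])
       (erule fin, rule that, auto)
  define F where "F = {x \<in> S. cmod (w x) = M}"
  define T where "T = S - F"
  have ST: "S = F \<union> T" "F \<inter> T = {}"
    by (auto simp: F_def T_def)
  have finF: "finite F" and F_ne: "F \<noteq> {}"
    using finF F_ne by (auto simp: F_def)
  define K1 where "K1 = infsum (\<lambda>x. m x * \<bar>Re (w x - 1)\<bar>) T"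
  define K2 where "K2 = infsum (\<lambda>x. m x * (cmod (w x - 1))\<^sup>2) T"
  define \<mu> where "\<mu> = sum m F"
  have \<mu>: "1 \<le> \<mu>"
  proof -
    obtain y where y: "y \<in> F" using F_ne by blast
    have "1 \<le> m y" using m y by (auto simp: F_def)
    also have "\<dots> \<le> \<mu>"
      unfolding \<mu>_def using finF y m0 by (intro member_le_sum) (auto simp: F_def)
    finally show ?thesis .
  qed
  have T_sub: "T \<subseteq> S" by (auto simp: T_def)
  have bound: "(\<lambda>x. m x * Re (1 - w x ^ n)) summable_on T"
    "infsum (\<lambda>x. m x * Re (1 - w x ^ n)) T \<le> real n * K1 + (real n)\<^sup>2 * r ^ n * K2" for n
  proof -
    have "0 \<le> m x" and "cmod (w x) \<le> r" if "x \<in> T" for x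
      using that m0 rest by (auto simp: T_def F_def)
    note * = weighted_power_sum_bound[of T m w r n, OF this(1) summable_on_subset_banach[OF s1 T_sub]
        summable_on_subset_banach[OF s2 T_sub] this(2) less_imp_le[OF r(1)]]
    show "(\<lambda>x. m x * Re (1 - w x ^ n)) summable_on T"
      by (rule *(1))
    show "infsum (\<lambda>x. m x * Re (1 - w x ^ n)) T \<le> real n * K1 + (real n)\<^sup>2 * r ^ n * K2"
      unfolding K1_def K2_def by (rule *(2))
  qed
  have upper: "infsum (\<lambda>x. m x * Re (1 - w x ^ n)) S
      \<le> \<mu> - \<mu> * M ^ n / 2 + (real n * K1 + (real n)\<^sup>2 * r ^ n * K2)"
    if n: "\<forall>z\<in>w ` F. Re (z ^ n) \<ge> cmod z ^ n / 2" for n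
  proof -
    have "infsum (\<lambda>x. m x * Re (1 - w x ^ n)) S
        = (\<Sum>x\<in>F. m x * Re (1 - w x ^ n)) + infsum (\<lambda>x. m x * Re (1 - w x ^ n)) T"
      using ST finF bound(1)[of n] by (simp add: infsum_Un_disjoint)
    also have "(\<Sum>x\<in>F. m x * Re (1 - w x ^ n)) \<le> (\<Sum>x\<in>F. m x * (1 - M ^ n / 2))"
      using n m0 by (intro sum_mono mult_left_mono) (auto simp: F_def)
    also have "\<dots> = \<mu> - \<mu> * M ^ n / 2"
      unfolding \<mu>_def sum_distrib_right[symmetric] by (simp add: right_diff_distrib)
    finally show ?thesis using bound(2)[of n] by simp
  qed
  \<comment> \<open>With \<open>\<epsilon> = ln r\<close> the permitted lower bound is of the same order \<open>r^n\<close> as the remainder.\<close>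
  obtain c where c: "0 < c"
    "\<And>n. 1 \<le> n \<Longrightarrow> infsum (\<lambda>x. m x * Re (1 - w x ^ n)) S \<ge> - c * exp (ln r * real n)"
    using lower[of "ln r"] r by auto
  have exp_r: "exp (ln r * real n) = r ^ n" for n
    using r by (simp add: exp_of_nat2_mult)
  have "eventually (\<lambda>n. \<mu> + real n * K1 + (real n)\<^sup>2 * r ^ n * K2 + c * r ^ n < \<mu> * M ^ n / 2) sequentially"
    using eventually_power_dominates[OF r, of \<mu> c K1 K2] \<mu> c(1) by simp
  then obtain L where L: "\<And>n. n \<ge> L \<Longrightarrow>
      \<mu> + real n * K1 + (real n)\<^sup>2 * r ^ n * K2 + c * r ^ n < \<mu> * M ^ n / 2"
    by (auto simp: eventually_sequentially)
  obtain n where n: "n \<ge> max 1 L" "\<forall>z\<in>w ` F. Re (z ^ n) \<ge> cmod z ^ n / 2"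
    using simultaneously_large_Re_power[of "w ` F" "max 1 L"] finF by auto
  show False
    using upper[OF n(2)] L[of n] c(2)[of n] n(1) exp_r[of n] by simp
qed

section \<open>The Moebius transformation\<close>

text \<open>
  The line \<open>Re \<rho> = \<sigma>\<close> is the perpendicular bisector of the points \<open>a\<close> and \<open>2 \<sigma> - a\<close>, whose distances
  to \<open>\<rho>\<close> are the moduli of numerator and denominator.
\<close>

lemma norm_reflected_quotient_eq_1_iff:
  fixes \<sigma> a :: real and \<rho> :: complex
  assumes "a \<noteq> \<sigma>" and "\<rho> + of_real a - 2 * of_real \<sigma> \<noteq> 0"
  shows "cmod ((\<rho> - of_real a) / (\<rho> + of_real a - 2 * of_real \<sigma>)) = 1 \<longleftrightarrow> Re \<rho> = \<sigma>"
proof -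
  have "(cmod (\<rho> - of_real a))\<^sup>2 - (cmod (\<rho> + of_real a - 2 * of_real \<sigma>))\<^sup>2
      = 4 * ((\<sigma> - a) * (Re \<rho> - \<sigma>))"
    unfolding cmod_power2 by (simp add: power2_eq_square algebra_simps)
  hence "(cmod (\<rho> - of_real a))\<^sup>2 = (cmod (\<rho> + of_real a - 2 * of_real \<sigma>))\<^sup>2
      \<longleftrightarrow> (\<sigma> - a) * (Re \<rho> - \<sigma>) = 0"
    by linarith
  moreover have "cmod ((\<rho> - of_real a) / (\<rho> + of_real a - 2 * of_real \<sigma>)) = 1
      \<longleftrightarrow> (cmod (\<rho> - of_real a))\<^sup>2 = (cmod (\<rho> + of_real a - 2 * of_real \<sigma>))\<^sup>2"
    using assms(2) by (auto simp: norm_divide)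
  ultimately show ?thesis using assms(1) by simp
qed

text \<open>
  With \<open>z = \<rho> + a - 2 \<sigma>\<close> one has \<open>w - 1 = 2 (\<sigma> - a) / z\<close>. Its real part is a multiple of
  \<open>Re z / |z|^2\<close>, which is why the hypothesis carries the factor \<open>1 + |Re \<rho>|\<close>; its squared modulus
  is a multiple of \<open>1 / |z|^2\<close>. To replace \<open>|z|^2\<close> by \<open>1 + |z|^2\<close> one needs \<open>z\<close> bounded away from
  0, and this holds because convergence leaves only finitely many \<open>\<rho>\<close> with \<open>|z| \<le> 1\<close>, and \<open>z\<close> vanishes
  for none of them.
\<close>

lemma reflected_quotient_summability:
  fixes \<sigma> a :: real and R :: "complex multiplicity"
  assumes nin: "2 * of_real \<sigma> - of_real a \<notin> elems_of R"
    and sum: "multi_summable R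
           (\<lambda>\<rho>. (1 + \<bar>Re \<rho>\<bar>) / (1 + (cmod (\<rho> + of_real a - 2 * of_real \<sigma>))\<^sup>2))"
  defines "w \<equiv> \<lambda>\<rho>. (\<rho> - of_real a) / (\<rho> + of_real a - 2 * of_real \<sigma>)"
  shows "(\<lambda>\<rho>. real (R \<rho>) * \<bar>Re (w \<rho> - 1)\<bar>) summable_on elems_of R"
    and "(\<lambda>\<rho>. real (R \<rho>) * (cmod (w \<rho> - 1))\<^sup>2) summable_on elems_of R"
proof -
  let ?S = "elems_of R"
  define z where "z \<rho> = \<rho> + of_real a - 2 * of_real \<sigma>" for \<rho> :: complex
  define h where "h \<rho> = (1 + \<bar>Re \<rho>\<bar>) / (1 + (cmod (z \<rho>))\<^sup>2)" for \<rho> :: complex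
  have h: "(\<lambda>\<rho>. real (R \<rho>) * h \<rho>) summable_on ?S"
    using sum by (simp add: multi_summable_def h_def z_def)
  have z_ne: "z \<rho> \<noteq> 0" if "\<rho> \<in> ?S" for \<rho>
  proof
    assume "z \<rho> = 0"
    hence "\<rho> = 2 * of_real \<sigma> - of_real a" unfolding z_def by algebra
    thus False using nin that by simp
  qed
  have "finite {\<rho> \<in> ?S. 1 / 2 \<le> real (R \<rho>) * h \<rho>}"
    by (intro finite_superlevel_if_summable_on[OF h]) (auto simp: h_def)
  moreover have "1 / 2 \<le> real (R \<rho>) * h \<rho>" if "\<rho> \<in> ?S" "cmod (z \<rho>) \<le> 1" for \<rho>
  proof -
    have "1 / 2 \<le> h \<rho>"
      unfolding h_def using that(2) by (intro frac_le) (auto simp: power_le_one add_pos_nonneg)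
    moreover have "1 * h \<rho> \<le> real (R \<rho>) * h \<rho>"
      using that(1) by (intro mult_right_mono) (auto simp: elems_of_def h_def)
    ultimately show ?thesis by linarith
  qed
  ultimately have fin: "finite {\<rho> \<in> ?S. cmod (z \<rho>) \<le> 1}"
    by (auto elim!: rev_finite_subset)
  define d where "d = Min (insert 1 ((\<lambda>\<rho>. cmod (z \<rho>)) ` {\<rho> \<in> ?S. cmod (z \<rho>) \<le> 1}))"
  have d: "0 < d"
    using fin z_ne by (auto simp: d_def)
  have d_le: "d \<le> cmod (z \<rho>)" if "\<rho> \<in> ?S" for \<rho>
  proof (cases "cmod (z \<rho>) \<le> 1")
    case True
    thus ?thesis using that fin by (auto simp: d_def intro!: Min_le)
  next
    case False
    have "d \<le> 1" using fin by (auto simp: d_def intro!: Min_le)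
    thus ?thesis using False by simp
  qed
  define C where "C = 1 / d\<^sup>2 + 1"
  have C: "0 < C" using d by (auto simp: C_def intro: add_nonneg_pos)
  have inv_le: "1 / (cmod (z \<rho>))\<^sup>2 \<le> C / (1 + (cmod (z \<rho>))\<^sup>2)" if "\<rho> \<in> ?S" for \<rho>
  proof -
    have pos: "0 < 1 + (cmod (z \<rho>))\<^sup>2" by (simp add: add_pos_nonneg)
    have "1 / (cmod (z \<rho>))\<^sup>2 * (1 + (cmod (z \<rho>))\<^sup>2) = 1 / (cmod (z \<rho>))\<^sup>2 + 1"
      using z_ne[OF that] by (simp add: field_simps)
    also have "\<dots> \<le> C"
      using d_le[OF that] d unfolding C_def by (intro add_right_mono frac_le power_mono) auto
    finally show ?thesis using pos by (simp add: pos_le_divide_eq)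
  qed
  define u where "u = 2 * (\<sigma> - a)"
  have w: "w \<rho> - 1 = of_real u / z \<rho>" if "\<rho> \<in> ?S" for \<rho>
    using z_ne[OF that] unfolding w_def z_def[symmetric]
    by (simp add: field_simps) (simp add: z_def u_def algebra_simps)
  have le1: "\<bar>Re (w \<rho> - 1)\<bar> \<le> \<bar>u\<bar> * (1 + \<bar>a - 2 * \<sigma>\<bar>) * C * h \<rho>" if "\<rho> \<in> ?S" for \<rho>
  proof -
    have "Re (w \<rho> - 1) = u * Re (z \<rho>) * (1 / (cmod (z \<rho>))\<^sup>2)"
      by (simp add: w[OF that] Re_divide cmod_power2)
    hence "\<bar>Re (w \<rho> - 1)\<bar> = \<bar>u\<bar> * \<bar>Re (z \<rho>)\<bar> * (1 / (cmod (z \<rho>))\<^sup>2)"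
      by (simp add: abs_mult)
    also have "\<dots> \<le> \<bar>u\<bar> * ((1 + \<bar>a - 2 * \<sigma>\<bar>) * (1 + \<bar>Re \<rho>\<bar>)) * (C / (1 + (cmod (z \<rho>))\<^sup>2))"
    proof (intro mult_mono inv_le that mult_nonneg_nonneg)
      have "\<bar>Re (z \<rho>)\<bar> \<le> \<bar>Re \<rho>\<bar> + \<bar>a - 2 * \<sigma>\<bar>" by (simp add: z_def)
      also have "\<dots> \<le> (1 + \<bar>a - 2 * \<sigma>\<bar>) * (1 + \<bar>Re \<rho>\<bar>)"
        by (simp add: algebra_simps)
      finally show "\<bar>Re (z \<rho>)\<bar> \<le> \<dots>" .
    qed auto
    finally show ?thesis by (simp add: h_def mult_ac)
  qed
  have le2: "(cmod (w \<rho> - 1))\<^sup>2 \<le> u\<^sup>2 * C * h \<rho>" if "\<rho> \<in> ?S" for \<rho>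
  proof -
    have "(cmod (w \<rho> - 1))\<^sup>2 = u\<^sup>2 * (1 / (cmod (z \<rho>))\<^sup>2)"
      by (simp add: w[OF that] norm_divide power_divide)
    also have "\<dots> \<le> u\<^sup>2 * (C * h \<rho>)"
    proof (intro mult_left_mono)
      have "C / (1 + (cmod (z \<rho>))\<^sup>2) \<le> C * (1 + \<bar>Re \<rho>\<bar>) / (1 + (cmod (z \<rho>))\<^sup>2)"
        using C by (intro divide_right_mono) auto
      thus "1 / (cmod (z \<rho>))\<^sup>2 \<le> C * h \<rho>"
        using inv_le[OF that] by (simp add: h_def)
    qed auto
    finally show ?thesis by (simp add: mult_ac)
  qed
  have comparison: "(\<lambda>\<rho>. real (R \<rho>) * g \<rho>) summable_on ?S"
    if "\<And>\<rho>. \<rho> \<in> ?S \<Longrightarrow> 0 \<le> g \<rho>" "\<And>\<rho>. \<rho> \<in> ?S \<Longrightarrow> g \<rho> \<le> B * h \<rho>" for g B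
  proof (rule summable_on_comparison_test)
    show "(\<lambda>\<rho>. B * (real (R \<rho>) * h \<rho>)) summable_on ?S"
      by (intro summable_on_cmult_right h)
    show "real (R \<rho>) * g \<rho> \<le> B * (real (R \<rho>) * h \<rho>)" if "\<rho> \<in> ?S" for \<rho>
      using mult_left_mono[OF \<open>\<And>\<rho>. \<rho> \<in> ?S \<Longrightarrow> g \<rho> \<le> B * h \<rho>\<close>[OF that], of "real (R \<rho>)"]
      by (simp add: mult_ac)
  qed (use that in auto)
  show "(\<lambda>\<rho>. real (R \<rho>) * \<bar>Re (w \<rho> - 1)\<bar>) summable_on ?S"
    by (rule comparison[OF _ le1]) auto
  show "(\<lambda>\<rho>. real (R \<rho>) * (cmod (w \<rho> - 1))\<^sup>2) summable_on ?S"
    by (rule comparison[OF _ le2]) auto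
qed

theorem theorem3:
  fixes \<sigma> a :: real and R :: "complex multiplicity"
  assumes "a \<noteq> \<sigma>"
    and "2 * of_real \<sigma> - of_real a \<notin> elems_of R"
    and "of_real a \<notin> elems_of R"
    and "multi_summable R
           (\<lambda>\<rho>. (1 + \<bar>Re \<rho>\<bar>) / (1 + (cmod (\<rho> + of_real a - 2 * of_real \<sigma>))\<^sup>2))"
    and "multi_summable R
           (\<lambda>\<rho>. (1 + \<bar>Re \<rho>\<bar>) / (1 + (cmod (\<rho> - of_real a))\<^sup>2))"
    and "\<And>\<rho>. \<rho> \<in> elems_of R \<Longrightarrow> 2 * of_real \<sigma> - \<rho> \<in> elems_of R"
  shows "((\<forall>\<rho>\<in>elems_of R. Re \<rho> = \<sigma>) \<longleftrightarrow> (\<forall>n\<ge>1. li_sum \<sigma> a R n \<ge> 0)) \<and>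
         ((\<forall>\<rho>\<in>elems_of R. Re \<rho> = \<sigma>) \<longleftrightarrow>
            (\<forall>\<epsilon>>0. \<exists>c>0. \<forall>n\<ge>1. li_sum \<sigma> a R n \<ge> - c * exp (\<epsilon> * real n)))"
proof -
  define w where "w \<rho> = (\<rho> - of_real a) / (\<rho> + of_real a - 2 * of_real \<sigma>)" for \<rho> :: complex
  have li: "li_sum \<sigma> a R n = infsum (\<lambda>\<rho>. real (R \<rho>) * Re (1 - w \<rho> ^ n)) (elems_of R)" for n
    by (simp add: li_sum_def multi_sum_def w_def)
  have ne: "\<rho> - of_real a \<noteq> 0" "\<rho> + of_real a - 2 * of_real \<sigma> \<noteq> 0" if "\<rho> \<in> elems_of R" for \<rho>
  proof -
    show "\<rho> - of_real a \<noteq> 0" using assms(3) that by auto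
    show "\<rho> + of_real a - 2 * of_real \<sigma> \<noteq> 0"
    proof
      assume "\<rho> + of_real a - 2 * of_real \<sigma> = 0"
      hence "\<rho> = 2 * of_real \<sigma> - of_real a" by algebra
      thus False using assms(2) that by simp
    qed
  qed
  have line_iff: "cmod (w \<rho>) = 1 \<longleftrightarrow> Re \<rho> = \<sigma>" if "\<rho> \<in> elems_of R" for \<rho>
    unfolding w_def by (rule norm_reflected_quotient_eq_1_iff[OF assms(1) ne(2)[OF that]])
  have refl: "w (2 * of_real \<sigma> - \<rho>) = inverse (w \<rho>)" for \<rho>
  proof -
    have "w (2 * of_real \<sigma> - \<rho>) = (- (\<rho> + of_real a - 2 * of_real \<sigma>)) / (- (\<rho> - of_real a))"
      by (simp add: w_def algebra_simps)
    thus ?thesis unfolding w_def minus_divide_divide by simp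
  qed
  have "li_sum \<sigma> a R n \<ge> 0" if "\<forall>\<rho>\<in>elems_of R. Re \<rho> = \<sigma>" for n
    unfolding li
  proof (intro infsum_nonneg mult_nonneg_nonneg)
    fix \<rho> assume "\<rho> \<in> elems_of R"
    hence "cmod (w \<rho> ^ n) = 1"
      using that line_iff by (simp add: norm_power)
    thus "0 \<le> Re (1 - w \<rho> ^ n)"
      using complex_Re_le_cmod[of "w \<rho> ^ n"] by simp
  qed auto
  moreover have "\<exists>c>0. \<forall>n\<ge>1. li_sum \<sigma> a R n \<ge> - c * exp (\<epsilon> * real n)"
    if "\<forall>n\<ge>1. li_sum \<sigma> a R n \<ge> 0" for \<epsilon> :: real
  proof (intro exI[of _ 1] conjI allI impI)
    fix n :: nat assume "1 \<le> n"
    have "- 1 * exp (\<epsilon> * real n) \<le> 0" by simp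
    also have "0 \<le> li_sum \<sigma> a R n" using that \<open>1 \<le> n\<close> by blast
    finally show "li_sum \<sigma> a R n \<ge> - 1 * exp (\<epsilon> * real n)" .
  qed simp
  moreover have "\<forall>\<rho>\<in>elems_of R. Re \<rho> = \<sigma>"
    if "\<forall>\<epsilon>>0. \<exists>c>0. \<forall>n\<ge>1. li_sum \<sigma> a R n \<ge> - c * exp (\<epsilon> * real n)"
  proof
    have le: "cmod (w \<rho>) \<le> 1" if "\<rho> \<in> elems_of R" for \<rho>
    proof (rule norm_le_1_if_power_sums_subexponential[OF _ _ _ _ that])
      show "(\<lambda>\<rho>. real (R \<rho>) * \<bar>Re (w \<rho> - 1)\<bar>) summable_on elems_of R"
        "(\<lambda>\<rho>. real (R \<rho>) * (cmod (w \<rho> - 1))\<^sup>2) summable_on elems_of R"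
        unfolding w_def by (rule reflected_quotient_summability[OF assms(2,4)])+
    qed (use \<open>\<forall>\<epsilon>>0. _ \<epsilon>\<close> in \<open>auto simp: elems_of_def[of R] li\<close>)
    fix \<rho> assume \<rho>: "\<rho> \<in> elems_of R"
    have "inverse (cmod (w \<rho>)) \<le> 1"
      using le[OF assms(6)[OF \<rho>]] by (simp add: refl norm_inverse)
    moreover have "0 < cmod (w \<rho>)"
      using ne[OF \<rho>] by (simp add: w_def)
    ultimately have "1 \<le> cmod (w \<rho>)"
      by (simp add: inverse_le_1_iff)
    thus "Re \<rho> = \<sigma>"
      using le[OF \<rho>] line_iff[OF \<rho>] by simp
  qed
  ultimately show ?thesis by blast
qed

end
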